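(* There are randomized algorithms which, given the vertex set $V(G)$ of a graph $G$ (whose edges are unknown) and positive integers $t$ and $k$: (a) with access to a BIS oracle for $G$, make $\mathcal{O}(k^4\log k)$ BIS queries and solve Decision-Cut, and (b) with access to a BISE oracle for $G$, make $\mathcal{O}(k^4\log k)$ BISE queries and solve Cut; each succeeds with probability at least $1-1/k^{c}$ for some constant $c>0$. Here Cut asks to output a partition $V_1\uplus\dots\uplus V_t$ of $V(G)$ such that at least $k$ edges have endpoints in different parts if such a partition exists, and otherwise to report that none exists; Decision-Cut asks to decide whether such a partition exists.
   Context: The BIS oracle takes two disjoint non-empty subsets $A,B\subseteq V(G)$ and answers whether some edge of $G$ has one endpoint in $A$ and the other in $B$. The BISE oracle takes the same input and returns such an edge (an arbitrary one) if one exists, and NULL otherwise. Only oracle queries are counted. *)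

theory Defs
  imports "HOL-Probability.Probability" "HOL-Library.Landau_Symbols"
begin

definition simple_graph :: "'a set \<Rightarrow> 'a set set \<Rightarrow> bool" where
  "simple_graph V E \<longleftrightarrow> finite V \<and> (\<forall>e\<in>E. e \<subseteq> V \<and> card e = 2)"

text \<open>
  A deterministic algorithm that may query an unknown input, once its known input is fixed, is a decision tree: it either
  stops with an output or asks a query and continues depending on the answer.  A randomized
  algorithm is a probability distribution over such trees.  Computation between queries is free.
\<close>

datatype ('q, 'r, 'o) dtree = Output 'o | Query 'q "'r \<Rightarrow> ('q, 'r, 'o) dtree"

text \<open>
  Oracles map the list of queries asked before and the current query to an answer.  The
  dependence on the past matters only where the answer is not determined by the graph: oracles
  that are free to return an arbitrary edge need not answer repeated queries consistently and
  may choose their edges adaptively.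
\<close>

type_synonym ('q, 'r) query_oracle = "'q list \<Rightarrow> 'q \<Rightarrow> 'r"

primrec queries_from :: "('q, 'r) query_oracle \<Rightarrow> 'q list \<Rightarrow> ('q, 'r, 'o) dtree \<Rightarrow> 'q list" where
  "queries_from orc h (Output x) = []"
| "queries_from orc h (Query q f) = q # queries_from orc (h @ [q]) (f (orc h q))"

primrec result_from :: "('q, 'r) query_oracle \<Rightarrow> 'q list \<Rightarrow> ('q, 'r, 'o) dtree \<Rightarrow> 'o" where
  "result_from orc h (Output x) = x"
| "result_from orc h (Query q f) = result_from orc (h @ [q]) (f (orc h q))"

definition queries :: "('q, 'r) query_oracle \<Rightarrow> ('q, 'r, 'o) dtree \<Rightarrow> 'q list" where
  "queries orc T = queries_from orc [] T"

definition result :: "('q, 'r) query_oracle \<Rightarrow> ('q, 'r, 'o) dtree \<Rightarrow> 'o" where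
  "result orc T = result_from orc [] T"

type_synonym 'a bip_query = "'a set \<times> 'a set"

definition legal_queries :: "'a set \<Rightarrow> 'a bip_query set" where
  "legal_queries V = {(A, B). A \<noteq> {} \<and> B \<noteq> {} \<and> A \<subseteq> V \<and> B \<subseteq> V \<and> A \<inter> B = {}}"

definition edges_between :: "'a set set \<Rightarrow> 'a set \<Rightarrow> 'a set \<Rightarrow> 'a set set" where
  "edges_between E A B = {e \<in> E. \<exists>a\<in>A. \<exists>b\<in>B. e = {a, b}}"

text \<open>Nothing is assumed about the answers to illegal queries.\<close>

definition bis_oracle :: "'a set \<Rightarrow> 'a set set \<Rightarrow> ('a bip_query, bool) query_oracle \<Rightarrow> bool" where
  "bis_oracle V E orc \<longleftrightarrow>
     (\<forall>h. \<forall>(A, B)\<in>legal_queries V. orc h (A, B) \<longleftrightarrow> edges_between E A B \<noteq> {})"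

definition bise_oracle :: "'a set \<Rightarrow> 'a set set \<Rightarrow> ('a bip_query, 'a set option) query_oracle \<Rightarrow> bool" where
  "bise_oracle V E orc \<longleftrightarrow>
     (\<forall>h. \<forall>(A, B)\<in>legal_queries V.
        case orc h (A, B) of
          None \<Rightarrow> edges_between E A B = {}
        | Some e \<Rightarrow> e \<in> edges_between E A B)"

text \<open>The parts are indexed and may be empty, so that \<open>t > card V\<close> is meaningful.\<close>

definition indexed_partition :: "'a set \<Rightarrow> nat \<Rightarrow> 'a set list \<Rightarrow> bool" where
  "indexed_partition V t Vs \<longleftrightarrow>
     length Vs = t \<and> disjoint_family_on (\<lambda>i. Vs ! i) {..<t} \<and> (\<Union>i<t. Vs ! i) = V"

definition crossing_edges :: "'a set set \<Rightarrow> 'a set list \<Rightarrow> 'a set set" where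
  "crossing_edges E Vs =
     {e \<in> E. \<exists>i<length Vs. \<exists>j<length Vs. i \<noteq> j \<and> (\<exists>u\<in>Vs ! i. \<exists>v\<in>Vs ! j. e = {u, v})}"

definition is_cut :: "'a set \<Rightarrow> 'a set set \<Rightarrow> nat \<Rightarrow> nat \<Rightarrow> 'a set list \<Rightarrow> bool" where
  "is_cut V E t k Vs \<longleftrightarrow> indexed_partition V t Vs \<and> card (crossing_edges E Vs) \<ge> k"

definition decision_cut_correct :: "'a set \<Rightarrow> 'a set set \<Rightarrow> nat \<Rightarrow> nat \<Rightarrow> bool \<Rightarrow> bool" where
  "decision_cut_correct V E t k b \<longleftrightarrow> (b \<longleftrightarrow> (\<exists>Vs. is_cut V E t k Vs))"

definition cut_correct :: "'a set \<Rightarrow> 'a set set \<Rightarrow> nat \<Rightarrow> nat \<Rightarrow> 'a set list option \<Rightarrow> bool" where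
  "cut_correct V E t k r \<longleftrightarrow>
     (case r of
        None \<Rightarrow> \<not> (\<exists>Vs. is_cut V E t k Vs)
      | Some Vs \<Rightarrow> is_cut V E t k Vs)"

end

theory Submission
  imports Defs
begin

text \<open>
  Colour the vertices uniformly at random with \<open>8 k\<^sup>2\<close> colours and query every pair of distinct
  colour classes.  If a cut has at least \<open>k\<close> crossing edges, choose \<open>k\<close> of them; with probability at
  least \<open>1/2\<close> their at most \<open>2 k\<close> endpoints get distinct colours.  Then each colour class can be put
  as a whole into the part of the chosen endpoint it contains, and the positive answers for the
  \<open>k\<close> pairs of classes alone certify that this coarsened partition has \<open>k\<close> crossing edges.  A
  certificate is never wrong, so with about \<open>log\<^sub>2 k\<close> independent colourings the error probability
  is at most \<open>1/k\<close>.  The queries do not depend on the answers, and all that is used of an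
  answer is whether an edge exists; hence the same algorithm serves both oracles.
\<close>

section \<open>Non-adaptive decision trees\<close>

primrec ask ::
  "('r \<Rightarrow> bool) \<Rightarrow> ('q set \<Rightarrow> 'o) \<Rightarrow> 'q list \<Rightarrow> 'q set \<Rightarrow> ('q, 'r, 'o) dtree" where
  "ask pos f [] P = Output (f P)"
| "ask pos f (q # qs) P = Query q (\<lambda>r. ask pos f qs (if pos r then insert q P else P))"

lemma queries_from_ask: "queries_from orc h (ask pos f qs P) = qs"
  by (induction qs arbitrary: h P) auto

lemma queries_ask: "queries orc (ask pos f qs P) = qs"
  by (simp add: queries_def queries_from_ask)

text \<open>The hypothesis ranges over all histories \<open>h\<close>: an oracle may vary which edge
  it returns, but whether it returns one is fixed by the graph.\<close>

lemma result_from_ask: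
  assumes "\<And>h q. q \<in> set qs \<Longrightarrow> pos (orc h q) \<longleftrightarrow> yes q"
  shows "result_from orc h (ask pos f qs P) = f (P \<union> {q \<in> set qs. yes q})"
  using assms
proof (induction qs arbitrary: h P)
  case (Cons q qs)
  have "insert q P \<union> {x \<in> set qs. yes x} = P \<union> {x \<in> set (q # qs). yes x}" if "yes q"
    using that by auto
  moreover have "P \<union> {x \<in> set qs. yes x} = P \<union> {x \<in> set (q # qs). yes x}" if "\<not> yes q"
    using that by auto
  ultimately show ?case
    using Cons by simp
qed simp

lemma result_ask:
  assumes "\<And>h q. q \<in> set qs \<Longrightarrow> pos (orc h q) \<longleftrightarrow> yes q"
  shows "result orc (ask pos f qs {}) = f {q \<in> set qs. yes q}"
  using assms by (simp add: result_def result_from_ask[where yes = yes])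

section \<open>Partitions as vertex labellings\<close>

lemma indexed_partition_map:
  assumes "g ` V \<subseteq> {..<t}"
  shows "indexed_partition V t (map (\<lambda>i. {v \<in> V. g v = i}) [0..<t])"
  using assms by (auto simp: indexed_partition_def disjoint_family_on_def)

text \<open>With a labelling \<open>g\<close> in place of the list of parts, an edge crosses iff its
  endpoints have different labels, and building a partition from colour classes becomes composition
  of functions.\<close>

lemma indexed_partitionE:
  assumes "indexed_partition V t Vs"
  obtains g where "g ` V \<subseteq> {..<t}" "Vs = map (\<lambda>i. {v \<in> V. g v = i}) [0..<t]"
proof -
  have len: "length Vs = t" and disj: "disjoint_family_on (\<lambda>i. Vs ! i) {..<t}"
    and un: "(\<Union>i<t. Vs ! i) = V"
    using assms by (auto simp: indexed_partition_def)
  have "\<forall>v\<in>V. \<exists>i<t. v \<in> Vs ! i"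
    using un by blast
  then obtain g where g: "\<And>v. v \<in> V \<Longrightarrow> g v < t \<and> v \<in> Vs ! g v"
    by metis
  have "Vs ! i = {v \<in> V. g v = i}" if "i < t" for i
  proof -
    have "g v = i" if "v \<in> Vs ! i" for v
    proof (rule ccontr)
      assume "g v \<noteq> i"
      moreover have "v \<in> V"
        using un that \<open>i < t\<close> by blast
      ultimately show False
        using disjoint_family_onD[OF disj, of "g v" i] g[of v] \<open>i < t\<close> that by auto
    qed
    then show ?thesis
      using g un \<open>i < t\<close> by blast
  qed
  then have "Vs = map (\<lambda>i. {v \<in> V. g v = i}) [0..<t]"
    using len by (intro nth_equalityI) auto
  moreover have "g ` V \<subseteq> {..<t}"
    using g by auto
  ultimately show thesis
    using that by blast
qed

lemma crossing_edges_map: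
  assumes "g ` V \<subseteq> {..<t}"
  shows "crossing_edges E (map (\<lambda>i. {v \<in> V. g v = i}) [0..<t]) =
    {e \<in> E. \<exists>u\<in>V. \<exists>v\<in>V. g u \<noteq> g v \<and> e = {u, v}}"
  using assms unfolding crossing_edges_def by (fastforce simp: image_subset_iff)

section \<open>Colour classes, their queries, and certified cuts\<close>

definition colour_class :: "'a set \<Rightarrow> ('a \<Rightarrow> nat) \<Rightarrow> nat \<Rightarrow> 'a set" where
  "colour_class V c i = {v \<in> V. c v = i}"

text \<open>Ordered pairs are used, so each pair of classes is asked in both orders; this avoids
  symmetry arguments. Empty classes would give illegal queries.\<close>

definition class_queries :: "'a set \<Rightarrow> nat \<Rightarrow> ('a \<Rightarrow> nat) \<Rightarrow> 'a bip_query list" where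
  "class_queries V m c =
     map (\<lambda>(i, j). (colour_class V c i, colour_class V c j))
       (filter (\<lambda>(i, j). i \<noteq> j \<and> colour_class V c i \<noteq> {} \<and> colour_class V c j \<noteq> {})
         (List.product [0..<m] [0..<m]))"

lemma class_queries_legal: "set (class_queries V m c) \<subseteq> legal_queries V"
  by (auto simp: class_queries_def legal_queries_def colour_class_def)

lemma length_class_queries: "length (class_queries V m c) \<le> m\<^sup>2"
  unfolding class_queries_def
  by (auto intro!: order_trans[OF length_filter_le] simp: power2_eq_square)

lemma mem_class_queries:
  assumes "u \<in> V" "v \<in> V" "c u < m" "c v < m" "c u \<noteq> c v"
  shows "(colour_class V c (c u), colour_class V c (c v)) \<in> set (class_queries V m c)"
proof -
  have "colour_class V c (c u) \<noteq> {}" "colour_class V c (c v) \<noteq> {}"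
    using assms by (auto simp: colour_class_def)
  then show ?thesis
    using assms unfolding class_queries_def by (auto intro!: image_eqI[of _ _ "(c u, c v)"])
qed

text \<open>
  Here \<open>P\<close> is the set of queries answered positively.  The quantification over all compatible
  graphs is harmless, since computation between queries is free.
\<close>

definition certified_cuts :: "'a set \<Rightarrow> nat \<Rightarrow> nat \<Rightarrow> 'a bip_query set \<Rightarrow> 'a set list set" where
  "certified_cuts V t k P =
     {Vs. \<forall>E. simple_graph V E \<longrightarrow> (\<forall>(A, B)\<in>P. edges_between E A B \<noteq> {}) \<longrightarrow> is_cut V E t k Vs}"

lemma certified_cuts_sound:
  assumes "simple_graph V E" "Vs \<in> certified_cuts V t k P"
    and "\<And>A B. (A, B) \<in> P \<Longrightarrow> edges_between E A B \<noteq> {}"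
  shows "is_cut V E t k Vs"
  using assms by (auto simp: certified_cuts_def)

lemma simple_graph_finite:
  assumes "simple_graph V E"
  shows "finite E"
  using assms by (auto simp: simple_graph_def intro: finite_subset[of E "Pow V"])

text \<open>Since \<open>c\<close> is injective on the endpoints of \<open>F\<close>, the
  \<open>k\<close> edges of \<open>F\<close> have \<open>k\<close> distinct colour pairs. In any
  compatible graph each of these pairs is realised by some edge, not necessarily one of
  \<open>F\<close>, and that edge crosses the partition built from whole colour classes.\<close>

lemma certified_cuts_complete:
  assumes t: "t > 0"
    and g: "g ` V \<subseteq> {..<t}" and F: "F \<subseteq> E" "card F = k"
    and cross: "\<And>e. e \<in> F \<Longrightarrow> \<exists>u\<in>V. \<exists>v\<in>V. g u \<noteq> g v \<and> e = {u, v}"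
    and c: "inj_on c (\<Union>F)" "c ` V \<subseteq> {..<m}"
    and P: "\<And>A B. \<lbrakk>(A, B) \<in> set (class_queries V m c); edges_between E A B \<noteq> {}\<rbrakk> \<Longrightarrow> (A, B) \<in> P"
  shows "certified_cuts V t k P \<noteq> {}"
proof -
  \<comment> \<open>A colour seen on an endpoint in \<open>F\<close> inherits the label of that
    endpoint. All other colours get the default 0, a valid label because
    \<open>t > 0\<close>.\<close>
  define part where "part i = (if i \<in> c ` \<Union>F then g (the_inv_into (\<Union>F) c i) else 0)" for i
  have part: "part (c u) = g u" if "u \<in> \<Union>F" for u
    unfolding part_def using that c(1) by (simp add: the_inv_into_f_f del: Union_iff)
  have FV: "\<Union>F \<subseteq> V"
    using cross by blast
  have "part i < t" for i
  proof (cases "i \<in> c ` \<Union>F")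
    case True
    then obtain u where "u \<in> \<Union>F" "i = c u" by blast
    then show ?thesis using part[of u] FV g by auto
  qed (use t in \<open>simp add: part_def\<close>)
  then have pt: "(part \<circ> c) ` V \<subseteq> {..<t}" by auto
  define Vs where "Vs = map (\<lambda>i. {v \<in> V. (part \<circ> c) v = i}) [0..<t]"
  have "is_cut V E' t k Vs"
    if E': "simple_graph V E'" and PE': "\<forall>(A, B)\<in>P. edges_between E' A B \<noteq> {}" for E'
  proof -
    let ?X = "crossing_edges E' Vs"
    have X: "?X = {e \<in> E'. \<exists>u\<in>V. \<exists>v\<in>V. part (c u) \<noteq> part (c v) \<and> e = {u, v}}"
      using crossing_edges_map[OF pt, of E'] by (simp add: Vs_def)
    have "(`) c ` F \<subseteq> (`) c ` ?X"
    proof (clarify)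
      fix e assume e: "e \<in> F"
      then obtain u v where uv: "u \<in> V" "v \<in> V" "g u \<noteq> g v" "e = {u, v}"
        using cross by blast
      have uvF: "u \<in> \<Union>F" "v \<in> \<Union>F"
        using e uv by auto
      have "u \<noteq> v"
        using uv by auto
      then have "c u \<noteq> c v"
        using inj_onD[OF c(1) _ uvF] by blast
      moreover have "c u < m" "c v < m"
        using uv c(2) by auto
      moreover have "edges_between E (colour_class V c (c u)) (colour_class V c (c v)) \<noteq> {}"
        using e F uv by (auto simp: edges_between_def colour_class_def)
      ultimately have "(colour_class V c (c u), colour_class V c (c v)) \<in> P"
        using mem_class_queries[of u V v c m] uv P by blast
      then have "edges_between E' (colour_class V c (c u)) (colour_class V c (c v)) \<noteq> {}"
        using PE' by blast
      then obtain a b where ab: "{a, b} \<in> E'" "a \<in> V" "b \<in> V" "c a = c u" "c b = c v"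
        by (auto simp: edges_between_def colour_class_def)
      moreover have "part (c a) \<noteq> part (c b)"
        using ab uv part[OF uvF(1)] part[OF uvF(2)] by simp
      ultimately have "{a, b} \<in> ?X"
        unfolding X by blast
      moreover have "c ` e = c ` {a, b}"
        using ab uv by auto
      ultimately show "c ` e \<in> (`) c ` ?X"
        by blast
    qed
    moreover have fin: "finite ?X"
      using simple_graph_finite[OF E'] X by auto
    moreover have "inj_on ((`) c) F"
      using c(1) by (rule inj_on_image)
    ultimately have "k \<le> card ?X"
      using F(2) by (metis card_image card_image_le card_mono finite_imageI order_trans)
    then show ?thesis
      using indexed_partition_map[OF pt] by (simp add: is_cut_def Vs_def)
  qed
  then have "Vs \<in> certified_cuts V t k P"
    by (simp add: certified_cuts_def)
  then show ?thesis
    by blast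
qed

section \<open>Counting and sampling random colourings\<close>

text \<open>Recolouring \<open>u\<close> arbitrarily loses no information: the old colour of
  \<open>u\<close> can be read off \<open>v\<close>. So (bad colouring, new colour) pairs inject
  into all colourings, which says that a collision has probability at most 1/m.\<close>

lemma card_colourings_collide:
  assumes "finite V" "u \<in> V" "v \<in> V" "u \<noteq> v"
  shows "card {c \<in> V \<rightarrow>\<^sub>E {..<m::nat}. c u = c v} * m \<le> card (V \<rightarrow>\<^sub>E {..<m})"
proof -
  let ?B = "{c \<in> V \<rightarrow>\<^sub>E {..<m}. c u = c v}"
  let ?f = "\<lambda>(c, x::nat). c(u := x)"
  have "inj_on ?f (?B \<times> {..<m})"
  proof (rule inj_onI, clarsimp)
    fix c d :: "'a \<Rightarrow> nat" and x y
    assume *: "c u = c v" "d u = d v" "c(u := x) = d(u := y)"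
    have "c w = d w" if "w \<noteq> u" for w
      using fun_cong[OF *(3), of w] that by simp
    then show "c = d \<and> x = y"
      using * assms(4) fun_cong[OF *(3), of u] by (metis ext fun_upd_same)
  qed
  moreover have "?f ` (?B \<times> {..<m}) \<subseteq> V \<rightarrow>\<^sub>E {..<m}"
    using assms by (auto simp: PiE_iff extensional_def)
  ultimately have "card (?B \<times> {..<m}) \<le> card (V \<rightarrow>\<^sub>E {..<m})"
    using assms(1) by (intro card_inj_on_le[of ?f]) (auto intro: finite_PiE)
  then show ?thesis
    by (simp add: card_cartesian_product)
qed

text \<open>Union bound over the ordered pairs of distinct elements of \<open>S\<close>.\<close>

lemma card_colourings_not_inj:
  assumes "finite V" "S \<subseteq> V"
  shows "card {c \<in> V \<rightarrow>\<^sub>E {..<m::nat}. \<not> inj_on c S} * m \<le> (card S)\<^sup>2 * card (V \<rightarrow>\<^sub>E {..<m})"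
proof -
  let ?C = "V \<rightarrow>\<^sub>E {..<m}"
  let ?I = "{(u, v) \<in> S \<times> S. u \<noteq> v}"
  let ?B = "\<lambda>(u, v). {c \<in> ?C. c u = c v}"
  have finS: "finite S"
    using assms finite_subset by blast
  then have finI: "finite ?I"
    by (intro finite_subset[of ?I "S \<times> S"]) auto
  have finC: "finite ?C"
    using assms(1) by (auto intro: finite_PiE)
  have "card {c \<in> ?C. \<not> inj_on c S} \<le> card (\<Union>p\<in>?I. ?B p)"
    using finI finC by (intro card_mono finite_UN_I) (auto simp: inj_on_def)
  also have "\<dots> \<le> (\<Sum>p\<in>?I. card (?B p))"
    using finI by (rule card_UN_le)
  finally have "card {c \<in> ?C. \<not> inj_on c S} * m \<le> (\<Sum>p\<in>?I. card (?B p) * m)"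
    unfolding sum_distrib_right[symmetric] by (rule mult_le_mono1)
  also have "\<dots> \<le> (\<Sum>p\<in>?I. card ?C)"
    using assms by (intro sum_mono) (auto intro!: card_colourings_collide)
  also have "\<dots> = card ?I * card ?C"
    by simp
  also have "\<dots> \<le> (card S)\<^sup>2 * card ?C"
  proof (rule mult_le_mono1)
    have "card ?I \<le> card (S \<times> S)"
      using finS by (intro card_mono) auto
    then show "card ?I \<le> (card S)\<^sup>2"
      by (simp add: card_cartesian_product power2_eq_square)
  qed
  finally show ?thesis .
qed

text \<open>A uniform list of length \<open>r\<close> over \<open>C\<close> stands for
  \<open>r\<close> independent uniform draws from \<open>C\<close>.\<close>

lemma prob_all_in_list:
  assumes "finite C" "C \<noteq> {}" "B \<subseteq> C"
  shows "measure_pmf.prob (pmf_of_set {xs. set xs \<subseteq> C \<and> length xs = r}) {xs. set xs \<subseteq> B}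
    = (real (card B) / real (card C)) ^ r"
proof -
  let ?L = "\<lambda>A. {xs. set xs \<subseteq> A \<and> length xs = r}"
  obtain x where "x \<in> C"
    using assms by blast
  then have "replicate r x \<in> ?L C"
    by auto
  then have ne: "?L C \<noteq> {}"
    by blast
  have "?L C \<inter> {xs. set xs \<subseteq> B} = ?L B"
    using assms by auto
  moreover have "finite B"
    using assms finite_subset by blast
  ultimately show ?thesis
    using assms ne
    by (simp add: measure_pmf_of_set finite_lists_length_eq card_lists_length_eq power_divide)
qed

section \<open>The algorithm and its failure probability\<close>

text \<open>At most 2k endpoints give at most 4k^2 ordered pairs, so this size makes the union bound
  equal to 1/2.\<close>

definition palette :: "nat \<Rightarrow> nat" where
  "palette k = 8 * k\<^sup>2"

text \<open>For k = 1 there are no rounds, which is consistent with the success bound 1 - 1/k =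
  0.\<close>

definition rounds :: "nat \<Rightarrow> nat" where
  "rounds k = nat \<lceil>log 2 (real k)\<rceil>"

definition colouring_lists :: "'a set \<Rightarrow> nat \<Rightarrow> ('a \<Rightarrow> nat) list set" where
  "colouring_lists V k = {cs. set cs \<subseteq> V \<rightarrow>\<^sub>E {..<palette k} \<and> length cs = rounds k}"

text \<open>All randomness is drawn before the first query, and the positive answers of all rounds
  are pooled. Decision and search differ only in \<open>out\<close>.\<close>

definition cut_alg ::
  "('r \<Rightarrow> bool) \<Rightarrow> ('a set list set \<Rightarrow> 'o) \<Rightarrow> 'a set \<Rightarrow> nat \<Rightarrow> nat \<Rightarrow>
    ('a bip_query, 'r, 'o) dtree pmf" where
  "cut_alg pos out V t k =
     map_pmf (\<lambda>cs. ask pos (\<lambda>P. out (certified_cuts V t k P))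
         (concat (map (class_queries V (palette k)) cs)) {})
       (pmf_of_set (colouring_lists V k))"

lemma power_rounds:
  assumes "k > 0"
  shows "real k \<le> 2 ^ rounds k"
proof -
  have "real k = 2 powr log 2 (real k)"
    using assms by simp
  also have "\<dots> \<le> 2 powr real (rounds k)"
    by (intro powr_mono) (auto simp: rounds_def real_nat_ceiling_ge)
  finally show ?thesis
    by (simp add: powr_realpow)
qed

lemma colouring_lists_finite_nonempty:
  assumes "finite V" "k > 0"
  shows "finite (colouring_lists V k)" "colouring_lists V k \<noteq> {}"
proof -
  show "finite (colouring_lists V k)"
    unfolding colouring_lists_def using assms by (intro finite_lists_length_eq finite_PiE) auto
  have "(\<lambda>v\<in>V. 0) \<in> V \<rightarrow>\<^sub>E {..<palette k}"
    using assms by (auto simp: palette_def)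
  then have "replicate (rounds k) (\<lambda>v\<in>V. 0) \<in> colouring_lists V k"
    by (auto simp: colouring_lists_def)
  then show "colouring_lists V k \<noteq> {}"
    by blast
qed

lemma prob_no_inj_colouring:
  assumes "finite V" "S \<subseteq> V" "card S \<le> 2 * k" "k > 0"
  shows "measure_pmf.prob (pmf_of_set (colouring_lists V k)) {cs. \<forall>c\<in>set cs. \<not> inj_on c S}
    \<le> 1 / real k"
proof -
  let ?m = "palette k"
  let ?C = "V \<rightarrow>\<^sub>E {..<?m}"
  let ?B = "{c \<in> ?C. \<not> inj_on c S}"
  have m: "?m > 0"
    using assms by (simp add: palette_def)
  have C: "finite ?C" "?C \<noteq> {}"
    using assms m by (auto intro: finite_PiE simp: PiE_eq_empty_iff)
  have "card ?B * ?m \<le> (card S)\<^sup>2 * card ?C"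
    using assms by (intro card_colourings_not_inj)
  also have "\<dots> \<le> (2 * k)\<^sup>2 * card ?C"
    using assms by (intro mult_le_mono1 power_mono) auto
  finally have "(2 * card ?B) * (4 * k\<^sup>2) \<le> card ?C * (4 * k\<^sup>2)"
    by (simp add: palette_def power_mult_distrib mult_ac)
  then have "2 * card ?B \<le> card ?C"
    using assms by simp
  then have half: "real (card ?B) / real (card ?C) \<le> 1 / 2"
    using C by (simp add: field_simps card_gt_0_iff)
  \<comment> \<open>The two events differ as sets but agree on the support, where every entry of a
    list lies in \<open>?C\<close>.\<close>
  have "measure_pmf.prob (pmf_of_set (colouring_lists V k)) {cs. \<forall>c\<in>set cs. \<not> inj_on c S}
      = measure_pmf.prob (pmf_of_set (colouring_lists V k)) {cs. set cs \<subseteq> ?B}"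
    using colouring_lists_finite_nonempty[of V k] assms
    by (intro measure_pmf.finite_measure_eq_AE)
      (auto simp: AE_measure_pmf_iff colouring_lists_def)
  also have "\<dots> = (real (card ?B) / real (card ?C)) ^ rounds k"
    unfolding colouring_lists_def using C by (intro prob_all_in_list) auto
  also have "\<dots> \<le> (1 / 2) ^ rounds k"
    using half by (intro power_mono) auto
  also have "\<dots> \<le> 1 / real k"
    using power_rounds[OF assms(4)] assms(4) by (simp add: power_divide field_simps)
  finally show ?thesis .
qed

section \<open>Query count and correctness\<close>

text \<open>Keeping exactly \<open>k\<close> of the crossing edges leaves at most 2k endpoints to
  separate, a bound independent of the graph.\<close>

lemma is_cutE:
  assumes "simple_graph V E" "is_cut V E t k Vs"
  obtains g F where "g ` V \<subseteq> {..<t}" "F \<subseteq> E" "card F = k" "\<Union>F \<subseteq> V" "card (\<Union>F) \<le> 2 * k"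
    "\<And>e. e \<in> F \<Longrightarrow> \<exists>u\<in>V. \<exists>v\<in>V. g u \<noteq> g v \<and> e = {u, v}"
proof -
  obtain g where g: "g ` V \<subseteq> {..<t}" and Vs: "Vs = map (\<lambda>i. {v \<in> V. g v = i}) [0..<t]"
    using assms(2) indexed_partitionE unfolding is_cut_def by blast
  have X: "crossing_edges E Vs = {e \<in> E. \<exists>u\<in>V. \<exists>v\<in>V. g u \<noteq> g v \<and> e = {u, v}}"
    unfolding Vs by (rule crossing_edges_map[OF g])
  obtain F where F: "F \<subseteq> crossing_edges E Vs" "card F = k"
    using assms(2) unfolding is_cut_def by (metis obtain_subset_with_card_n)
  have FE: "F \<subseteq> E"
    using F X by auto
  have "card (\<Union>F) \<le> sum card F"
    by (rule card_Union_le_sum_card)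
  also have "\<dots> = 2 * k"
    using assms(1) FE F(2) by (simp add: simple_graph_def subset_iff)
  finally have "card (\<Union>F) \<le> 2 * k" .
  moreover have "\<Union>F \<subseteq> V"
    using assms(1) FE by (auto simp: simple_graph_def)
  moreover have "\<exists>u\<in>V. \<exists>v\<in>V. g u \<noteq> g v \<and> e = {u, v}" if "e \<in> F" for e
    using that F X by blast
  ultimately show thesis
    using that g FE F(2) by blast
qed

lemma cut_alg_queries:
  assumes "finite V" "k > 0" "T \<in> set_pmf (cut_alg pos out V t k)"
  shows "set (queries orc T) \<subseteq> legal_queries V"
    and "length (queries orc T) \<le> rounds k * (palette k)\<^sup>2"
proof -
  obtain cs where cs: "cs \<in> colouring_lists V k"
    and "T = ask pos (\<lambda>P. out (certified_cuts V t k P))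
      (concat (map (class_queries V (palette k)) cs)) {}"
    using assms colouring_lists_finite_nonempty[of V k] by (auto simp: cut_alg_def)
  then have T: "queries orc T = concat (map (class_queries V (palette k)) cs)"
    by (simp add: queries_ask)
  show "set (queries orc T) \<subseteq> legal_queries V"
    using class_queries_legal unfolding T by fastforce
  have "length (concat (map (class_queries V (palette k)) cs)) \<le> length cs * (palette k)\<^sup>2"
    by (induction cs) (auto intro: add_mono length_class_queries)
  then show "length (queries orc T) \<le> rounds k * (palette k)\<^sup>2"
    using cs by (simp add: T colouring_lists_def)
qed

text \<open>The error is one-sided: certified cuts are always genuine, so the algorithm can fail
  only when a cut exists and no round separates the chosen endpoints. The hypothesis on
  \<open>out\<close> isolates what both problems need: a set of genuine cuts that is empty only if
  there is no cut.\<close>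

lemma cut_alg_correct:
  assumes G: "simple_graph V E" and t: "t > 0" and k: "k > 0"
    and orc: "\<And>h A B. (A, B) \<in> legal_queries V \<Longrightarrow>
      pos (orc h (A, B)) \<longleftrightarrow> edges_between E A B \<noteq> {}"
    and out: "\<And>X. \<lbrakk>X \<subseteq> {Vs. is_cut V E t k Vs}; X = {} \<Longrightarrow> \<nexists>Vs. is_cut V E t k Vs\<rbrakk>
      \<Longrightarrow> correct (out X)"
  shows "measure_pmf.prob (cut_alg pos out V t k) {T. correct (result orc T)} \<ge> 1 - 1 / real k"
proof -
  let ?L = "pmf_of_set (colouring_lists V k)"
  let ?qs = "\<lambda>cs. concat (map (class_queries V (palette k)) cs)"
  let ?P = "\<lambda>cs. {(A, B) \<in> set (?qs cs). edges_between E A B \<noteq> {}}"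
  let ?T = "\<lambda>cs. ask pos (\<lambda>P. out (certified_cuts V t k P)) (?qs cs) {}"
  have V: "finite V"
    using G by (simp add: simple_graph_def)
  have result: "result orc (?T cs) = out (certified_cuts V t k (?P cs))" for cs
  proof -
    have "set (?qs cs) \<subseteq> legal_queries V"
      using class_queries_legal by fastforce
    then have "pos (orc h q) \<longleftrightarrow> (case q of (A, B) \<Rightarrow> edges_between E A B \<noteq> {})"
      if "q \<in> set (?qs cs)" for h q
      using that orc by (cases q) blast
    then show ?thesis
      by (subst result_ask[where yes = "\<lambda>(A, B). edges_between E A B \<noteq> {}"])
        (auto simp: case_prod_unfold)
  qed
  have sound: "certified_cuts V t k (?P cs) \<subseteq> {Vs. is_cut V E t k Vs}" for cs
    using certified_cuts_sound[OF G] by blast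
  \<comment> \<open>\<open>S\<close> is chosen from the graph alone, before the colourings are
    drawn, as \<open>prob_no_inj_colouring\<close> requires. If no cut exists, every run is correct
    and the empty set serves.\<close>
  have "\<exists>S. S \<subseteq> V \<and> card S \<le> 2 * k \<and>
    (\<forall>cs\<in>colouring_lists V k. \<forall>c\<in>set cs. inj_on c S \<longrightarrow> correct (result orc (?T cs)))"
  proof (cases "\<exists>Vs. is_cut V E t k Vs")
    case True
    then obtain g F where g: "g ` V \<subseteq> {..<t}" and F: "F \<subseteq> E" "card F = k"
      and S: "\<Union>F \<subseteq> V" "card (\<Union>F) \<le> 2 * k"
      and cross: "\<And>e. e \<in> F \<Longrightarrow> \<exists>u\<in>V. \<exists>v\<in>V. g u \<noteq> g v \<and> e = {u, v}"
      using is_cutE[OF G] by blast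
    have "correct (result orc (?T cs))"
      if "cs \<in> colouring_lists V k" "c \<in> set cs" "inj_on c (\<Union>F)" for cs c
    proof -
      have "c ` V \<subseteq> {..<palette k}"
        using that by (auto simp: colouring_lists_def)
      \<comment> \<open>One injective round suffices: positive answers from other rounds only shrink
        the family of compatible graphs.\<close>
      then have "certified_cuts V t k (?P cs) \<noteq> {}"
        using that by (intro certified_cuts_complete[OF t g F cross, where c = c]) auto
      then show ?thesis
        unfolding result by (intro out sound) simp
    qed
    then show ?thesis
      using S by blast
  next
    case False
    then have "correct (result orc (?T cs))" for cs
      unfolding result by (intro out sound)
    then show ?thesis
      by (intro exI[of _ "{}"]) auto
  qed
  then obtain S where S: "S \<subseteq> V" "card S \<le> 2 * k"
    and good: "\<forall>cs\<in>colouring_lists V k. \<forall>c\<in>set cs. inj_on c S \<longrightarrow>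
      correct (result orc (?T cs))"
    by (elim exE conjE)
  let ?bad = "{cs. \<forall>c\<in>set cs. \<not> inj_on c S}"
  have "1 - 1 / real k \<le> 1 - measure_pmf.prob ?L ?bad"
    using prob_no_inj_colouring[OF V S k] by simp
  also have "\<dots> = measure_pmf.prob ?L (- ?bad)"
    using measure_pmf.prob_compl[of ?bad ?L] by (simp add: Compl_eq_Diff_UNIV)
  also have "\<dots> \<le> measure_pmf.prob ?L {cs. correct (result orc (?T cs))}"
    using colouring_lists_finite_nonempty[OF V k] good
    by (intro measure_pmf.finite_measure_mono_AE) (auto simp: AE_measure_pmf_iff)
  also have "\<dots> = measure_pmf.prob (cut_alg pos out V t k) {T. correct (result orc T)}"
    by (simp add: cut_alg_def measure_map_pmf vimage_def)
  finally show ?thesis .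
qed

section \<open>Asymptotic query bound and both oracles\<close>

text \<open>The squared palette is 64 k^4, and for k at least 2 rounding the logarithm up at most
  doubles it; changing to \<open>ln\<close> yields 128 / ln 2.\<close>

lemma query_bound_bigo:
  "(\<lambda>k. real (rounds k * (palette k)\<^sup>2)) \<in> O(\<lambda>k. real k ^ 4 * ln (real k))"
proof (rule bigoI)
  show "\<forall>\<^sub>F k in sequentially. norm (real (rounds k * (palette k)\<^sup>2))
      \<le> (128 / ln 2) * norm (real k ^ 4 * ln (real k))"
    using eventually_ge_at_top[of 2]
  proof eventually_elim
    case (elim k)
    have log: "1 \<le> log 2 (real k)"
      using elim by simp
    then have "real (rounds k) \<le> 2 * log 2 (real k)"
      unfolding rounds_def by linarith
    then have "real (rounds k) * (64 * real k ^ 4) \<le> 2 * log 2 (real k) * (64 * real k ^ 4)"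
      by (intro mult_right_mono) auto
    then show ?case
      using elim by (simp add: palette_def power_mult_distrib log_def mult_ac abs_mult)
  qed
qed

theorem theorem8:
  shows
    "(\<exists>(alg :: 'a set \<Rightarrow> nat \<Rightarrow> nat \<Rightarrow> ('a bip_query, bool, bool) dtree pmf)
        (q :: nat \<Rightarrow> nat) (c :: real).
        (\<lambda>k. real (q k)) \<in> O(\<lambda>k. real k ^ 4 * ln (real k)) \<and> c > 0 \<and>
        (\<forall>V E t k orc.
           simple_graph V E \<longrightarrow> t > 0 \<longrightarrow> k > 0 \<longrightarrow> bis_oracle V E orc \<longrightarrow>
             (\<forall>T\<in>set_pmf (alg V t k).
                set (queries orc T) \<subseteq> legal_queries V \<and> length (queries orc T) \<le> q k) \<and>
             measure_pmf.prob (alg V t k) {T. decision_cut_correct V E t k (result orc T)}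
               \<ge> 1 - 1 / real k powr c)) \<and>
     (\<exists>(alg :: 'a set \<Rightarrow> nat \<Rightarrow> nat \<Rightarrow> ('a bip_query, 'a set option, 'a set list option) dtree pmf)
        (q :: nat \<Rightarrow> nat) (c :: real).
        (\<lambda>k. real (q k)) \<in> O(\<lambda>k. real k ^ 4 * ln (real k)) \<and> c > 0 \<and>
        (\<forall>V E t k orc.
           simple_graph V E \<longrightarrow> t > 0 \<longrightarrow> k > 0 \<longrightarrow> bise_oracle V E orc \<longrightarrow>
             (\<forall>T\<in>set_pmf (alg V t k).
                set (queries orc T) \<subseteq> legal_queries V \<and> length (queries orc T) \<le> q k) \<and>
             measure_pmf.prob (alg V t k) {T. cut_correct V E t k (result orc T)}
               \<ge> 1 - 1 / real k powr c))"
proof (intro conjI)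
  have decision: "decision_cut_correct V E t k (X \<noteq> {})"
    if "X \<subseteq> {Vs. is_cut V E t k Vs}" "X = {} \<Longrightarrow> \<nexists>Vs. is_cut V E t k Vs"
    for V :: "'a set" and E t k X
    using that by (auto simp: decision_cut_correct_def)
  have bis: "orc h (A, B) \<longleftrightarrow> edges_between E A B \<noteq> {}"
    if "bis_oracle V E orc" "(A, B) \<in> legal_queries V" for V :: "'a set" and E orc h A B
    using that unfolding bis_oracle_def by fastforce
  show "\<exists>(alg :: 'a set \<Rightarrow> nat \<Rightarrow> nat \<Rightarrow> ('a bip_query, bool, bool) dtree pmf)
        (q :: nat \<Rightarrow> nat) (c :: real).
        (\<lambda>k. real (q k)) \<in> O(\<lambda>k. real k ^ 4 * ln (real k)) \<and> c > 0 \<and>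
        (\<forall>V E t k orc.
           simple_graph V E \<longrightarrow> t > 0 \<longrightarrow> k > 0 \<longrightarrow> bis_oracle V E orc \<longrightarrow>
             (\<forall>T\<in>set_pmf (alg V t k).
                set (queries orc T) \<subseteq> legal_queries V \<and> length (queries orc T) \<le> q k) \<and>
             measure_pmf.prob (alg V t k) {T. decision_cut_correct V E t k (result orc T)}
               \<ge> 1 - 1 / real k powr c)"
  proof (rule exI[of _ "cut_alg (\<lambda>r. r) (\<lambda>X. X \<noteq> {})"],
      rule exI[of _ "\<lambda>k. rounds k * (palette k)\<^sup>2"], rule exI[of _ 1],
      intro conjI allI impI ballI query_bound_bigo)
    fix V :: "'a set" and E and t k :: nat and orc
    assume G: "simple_graph V E" and t: "t > 0" and k: "k > 0" and orc: "bis_oracle V E orc"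
    have V: "finite V"
      using G by (simp add: simple_graph_def)
    show "set (queries orc T) \<subseteq> legal_queries V"
      and "length (queries orc T) \<le> rounds k * (palette k)\<^sup>2"
      if "T \<in> set_pmf (cut_alg (\<lambda>r. r) (\<lambda>X. X \<noteq> {}) V t k)" for T
      using cut_alg_queries[OF V k that] by auto
    show "1 - 1 / real k powr 1 \<le> measure_pmf.prob
        (cut_alg (\<lambda>r. r) (\<lambda>X. X \<noteq> {}) V t k)
        {T. decision_cut_correct V E t k (result orc T)}"
      using k cut_alg_correct[where pos = "\<lambda>r. r" and out = "\<lambda>X. X \<noteq> {}"
          and correct = "decision_cut_correct V E t k", OF G t k bis[OF orc] decision]
      by simp
  qed simp
next
  have cut: "cut_correct V E t k (if X = {} then None else Some (SOME Vs. Vs \<in> X))"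
    if "X \<subseteq> {Vs. is_cut V E t k Vs}" "X = {} \<Longrightarrow> \<nexists>Vs. is_cut V E t k Vs"
    for V :: "'a set" and E t k X
    using that by (auto simp: cut_correct_def some_in_eq subset_iff)
  \<comment> \<open>Only whether an edge was returned is kept, so adaptive or inconsistent choices
    of edges do no harm.\<close>
  have bise: "orc h (A, B) \<noteq> None \<longleftrightarrow> edges_between E A B \<noteq> {}"
    if "bise_oracle V E orc" "(A, B) \<in> legal_queries V" for V :: "'a set" and E orc h A B
  proof -
    have "case orc h (A, B) of None \<Rightarrow> edges_between E A B = {} | Some e \<Rightarrow> e \<in> edges_between E A B"
      using that unfolding bise_oracle_def by blast
    then show ?thesis
      by (auto split: option.splits)
  qed
  show "\<exists>(alg :: 'a set \<Rightarrow> nat \<Rightarrow> nat \<Rightarrow> ('a bip_query, 'a set option, 'a set list option) dtree pmf)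
        (q :: nat \<Rightarrow> nat) (c :: real).
        (\<lambda>k. real (q k)) \<in> O(\<lambda>k. real k ^ 4 * ln (real k)) \<and> c > 0 \<and>
        (\<forall>V E t k orc.
           simple_graph V E \<longrightarrow> t > 0 \<longrightarrow> k > 0 \<longrightarrow> bise_oracle V E orc \<longrightarrow>
             (\<forall>T\<in>set_pmf (alg V t k).
                set (queries orc T) \<subseteq> legal_queries V \<and> length (queries orc T) \<le> q k) \<and>
             measure_pmf.prob (alg V t k) {T. cut_correct V E t k (result orc T)}
               \<ge> 1 - 1 / real k powr c)"
  proof (rule exI[of _ "cut_alg (\<lambda>r. r \<noteq> None) (\<lambda>X. if X = {} then None else Some (SOME Vs. Vs \<in> X))"],
      rule exI[of _ "\<lambda>k. rounds k * (palette k)\<^sup>2"], rule exI[of _ 1],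
      intro conjI allI impI ballI query_bound_bigo)
    fix V :: "'a set" and E and t k :: nat and orc
    assume G: "simple_graph V E" and t: "t > 0" and k: "k > 0" and orc: "bise_oracle V E orc"
    have V: "finite V"
      using G by (simp add: simple_graph_def)
    show "set (queries orc T) \<subseteq> legal_queries V"
      and "length (queries orc T) \<le> rounds k * (palette k)\<^sup>2"
      if "T \<in> set_pmf (cut_alg (\<lambda>r. r \<noteq> None) (\<lambda>X. if X = {} then None else Some (SOME Vs. Vs \<in> X)) V t k)" for T
      using cut_alg_queries[OF V k that] by auto
    show "1 - 1 / real k powr 1 \<le> measure_pmf.prob
        (cut_alg (\<lambda>r. r \<noteq> None) (\<lambda>X. if X = {} then None else Some (SOME Vs. Vs \<in> X)) V t k)
        {T. cut_correct V E t k (result orc T)}"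
      using k cut_alg_correct[where pos = "\<lambda>r. r \<noteq> None" and out = "\<lambda>X. if X = {} then None else Some (SOME Vs. Vs \<in> X)"
          and correct = "cut_correct V E t k", OF G t k bise[OF orc] cut]
      by simp
  qed simp
qed

end
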